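(* Let $n = 2^k$ with $k \geq 0$ an integer, and let $A = \frac{1}{\sqrt{k+1}} A_k \in \mathbb{R}^{n \times n}$, where $A_k$ is the explicit matrix (the transpose of the discrete Haar transform) defined in the context. Then every row of $A$ has $\ell^2$-norm $1$, the value $\|Ax\|_{\ell^{\infty}}$ is the same for all $x \in \{-1,1\}^n$, and $$\frac{1}{2^{n}}\sum_{x \in \{-1,1\}^n} \|Ax\|_{\ell^{\infty}} = \sqrt{\log_2 n + 1}.$$ In particular, as $n \to \infty$ along powers of $2$, this quantity is asymptotic to $\sqrt{\frac{1}{\log 2} \log n}$, where $\frac{1}{\log 2} = 1.442\ldots$.
   Context: The matrices $A_k \in \mathbb{R}^{2^k \times 2^k}$ are defined recursively (up to a reordering of rows and columns, which is irrelevant here, $A_k$ is the transpose of the matrix of the unnormalized discrete Haar wavelet transform) by $A_0 = (1)$ and $$A_{k+1} = \begin{pmatrix} A_k & \mathrm{Id}_{2^k \times 2^k} \\ A_k & -\mathrm{Id}_{2^k \times 2^k} \end{pmatrix}.$$ Here $\|v\|_{\ell^\infty} = \max_i |v_i|$, $\log$ is the natural logarithm and $\log_2$ the logarithm to base $2$. *)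

theory Defs
  imports
    "HOL-Analysis.L2_Norm"
    "HOL-Library.Landau_Symbols"
    "Jordan_Normal_Form.Matrix"
begin

fun haar_mat :: "nat \<Rightarrow> real mat" where
  "haar_mat 0 = 1\<^sub>m 1"
| "haar_mat (Suc k) =
     four_block_mat (haar_mat k) (1\<^sub>m (2 ^ k))
                    (haar_mat k) (- 1\<^sub>m (2 ^ k))"

definition normalized_haar_mat :: "nat \<Rightarrow> real mat" where
  "normalized_haar_mat k = (1 / sqrt (real k + 1)) \<cdot>\<^sub>m haar_mat k"

definition l2_norm :: "real vec \<Rightarrow> real" where
  "l2_norm v = L2_set (\<lambda>i. v $ i) {..<dim_vec v}"

text \<open>Only meaningful for vectors of positive dimension, since \<^const>\<open>Max\<close> is
  unspecified on the empty set; the dimensions used here are powers of two.\<close>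

definition linf_norm :: "real vec \<Rightarrow> real" where
  "linf_norm v = Max ((\<lambda>i. \<bar>v $ i\<bar>) ` {..<dim_vec v})"

definition sign_vecs :: "nat \<Rightarrow> real vec set" where
  "sign_vecs n = {x \<in> carrier_vec n. \<forall>i<n. x $ i \<in> {-1, 1}}"

definition mean_linf_norm :: "nat \<Rightarrow> real mat \<Rightarrow> real" where
  "mean_linf_norm n A = (1 / 2 ^ n) * (\<Sum>x\<in>sign_vecs n. linf_norm (A *\<^sub>v x))"

lemma haar_mat_carrier: "haar_mat k \<in> carrier_mat (2 ^ k) (2 ^ k)"
proof (induction k)
  case (Suc k)
  then show ?case
    using four_block_carrier_mat[OF Suc, of "- 1\<^sub>m (2 ^ k)" "2 ^ k" "2 ^ k"]
    by (simp add: mult_2)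
qed simp

lemma normalized_haar_mat_carrier:
  "normalized_haar_mat k \<in> carrier_mat (2 ^ k) (2 ^ k)"
  using haar_mat_carrier by (simp add: normalized_haar_mat_def)

lemma finite_sign_vecs: "finite (sign_vecs n)"
proof (rule finite_subset)
  show "sign_vecs n \<subseteq> vec_of_list ` {xs. set xs \<subseteq> {-1, 1} \<and> length xs = n}"
  proof
    fix x assume x: "x \<in> sign_vecs n"
    then have "set (list_of_vec x) \<subseteq> {-1, 1}" "length (list_of_vec x) = n"
      by (auto simp: sign_vecs_def in_set_conv_nth list_of_vec_index carrier_vecD)
    then show "x \<in> vec_of_list ` {xs. set xs \<subseteq> {-1, 1} \<and> length xs = n}"
      by (metis (mono_tags, lifting) image_eqI mem_Collect_eq vec_list)
  qed
  show "finite (vec_of_list ` {xs. set xs \<subseteq> {-1, 1::real} \<and> length xs = n})"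
    by (intro finite_imageI finite_lists_length_eq) simp
qed

end

theory Submission
  imports "HOL-Analysis.Harmonic_Numbers" "HOL-Real_Asymp.Real_Asymp" Defs
begin

unbundle no vec_syntax

text \<open>
  Multiplying the block matrix by a sign vector split into halves \<open>u\<close> and \<open>v\<close> gives the two
  halves \<open>A\<^sub>k u + v\<close> and \<open>A\<^sub>k u - v\<close>. For real numbers \<open>a\<close> and \<open>s = \<plusminus>1\<close> the larger of
  \<open>\<bar>a + s\<bar>\<close> and \<open>\<bar>a - s\<bar>\<close> is always \<open>\<bar>a\<bar> + 1\<close>, whichever sign \<open>s\<close> has. Hence each level of the
  recursion raises the maximum norm by exactly one (\<open>linf_norm_butterfly\<close>), so that
  \<open>A\<^sub>k x\<close> has norm \<open>k + 1\<close> for \<^emph>\<open>every\<close> sign vector \<open>x\<close> (\<open>linf_norm_haar_mult\<close>). There is nothing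
  left to average: after scaling, the mean is \<open>(k + 1) / sqrt (k + 1) = sqrt (k + 1)\<close>.

  The rows behave in the same way: a row of \<open>A\<^sub>k\<^sub>+\<^sub>1\<close> is a row of \<open>A\<^sub>k\<close> followed by plus or minus a
  unit vector, so its squared Euclidean norm is one larger (\<open>l2_norm_row_haar\<close>). The numerical
  value of \<open>1 / ln 2\<close> comes from the first three terms of the area hyperbolic tangent series for
  the logarithm.
\<close>

section \<open>Rows\<close>

lemma sum_lessThan_add:
  fixes f :: "nat \<Rightarrow> 'a :: comm_monoid_add"
  shows "sum f {..<m + n} = sum f {..<m} + (\<Sum>i<n. f (m + i))"
  by (induction n) (simp_all add: ac_simps)

lemma l2_norm_append:
  "(l2_norm (u @\<^sub>v v))\<^sup>2 = (l2_norm u)\<^sup>2 + (l2_norm v)\<^sup>2"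
proof -
  have "(\<Sum>i<dim_vec u + dim_vec v. ((u @\<^sub>v v) $ i)\<^sup>2)
      = (\<Sum>i<dim_vec u. ((u @\<^sub>v v) $ i)\<^sup>2) + (\<Sum>i<dim_vec v. ((u @\<^sub>v v) $ (dim_vec u + i))\<^sup>2)"
    by (rule sum_lessThan_add)
  then show ?thesis
    by (simp add: l2_norm_def L2_set_def sum_nonneg)
qed

lemma l2_norm_uminus: "l2_norm (- v) = l2_norm v"
  by (simp add: l2_norm_def L2_set_def)

lemma l2_norm_unit_vec: "i < n \<Longrightarrow> l2_norm (unit_vec n i) = 1"
  by (simp add: l2_norm_def L2_set_def if_distrib[of "\<lambda>x. x\<^sup>2"] cong: if_cong)

lemma l2_norm_smult: "l2_norm (c \<cdot>\<^sub>v v) = \<bar>c\<bar> * l2_norm v"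
  by (simp add: l2_norm_def L2_set_def power_mult_distrib real_sqrt_mult flip: sum_distrib_left)

lemma l2_norm_row_haar:
  "i < 2 ^ k \<Longrightarrow> (l2_norm (row (haar_mat k) i))\<^sup>2 = real k + 1"
proof (induction k arbitrary: i)
  case 0
  then show ?case
    by (simp add: l2_norm_unit_vec)
next
  case (Suc k)
  let ?n = "2 ^ k :: nat"
  have neg: "- 1\<^sub>m ?n \<in> carrier_mat ?n ?n"
    by simp
  note rows = row_four_block_mat[OF haar_mat_carrier one_carrier_mat haar_mat_carrier neg]
  have neg_row: "row (- 1\<^sub>m ?n) j = - (unit_vec ?n j :: real vec)" if "j < ?n" for j
    using that by (simp flip: row_one)
  show ?case
  proof (cases "i < ?n")
    case True
    with Suc.IH show ?thesis
      by (simp add: rows(1) l2_norm_append l2_norm_unit_vec)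
  next
    case False
    with Suc.prems have "i < ?n + ?n" "i - ?n < ?n"
      by auto
    with False Suc.IH[of "i - ?n"] show ?thesis
      by (simp add: rows(2) l2_norm_append neg_row l2_norm_uminus l2_norm_unit_vec)
  qed
qed

section \<open>Images of sign vectors\<close>

lemma linf_norm_smult:
  assumes "0 < dim_vec v"
  shows "linf_norm (c \<cdot>\<^sub>v v) = \<bar>c\<bar> * linf_norm v"
proof -
  have "Max ((\<lambda>a. \<bar>c\<bar> * a) ` (\<lambda>i. \<bar>v $ i\<bar>) ` {..<dim_vec v})
      = \<bar>c\<bar> * Max ((\<lambda>i. \<bar>v $ i\<bar>) ` {..<dim_vec v})"
    using assms by (intro mono_Max_commute[symmetric] monoI mult_left_mono) auto
  moreover have "(\<lambda>i. \<bar>(c \<cdot>\<^sub>v v) $ i\<bar>) ` {..<dim_vec v}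
      = (\<lambda>a. \<bar>c\<bar> * a) ` (\<lambda>i. \<bar>v $ i\<bar>) ` {..<dim_vec v}"
    unfolding image_image by (intro image_cong) (simp_all add: abs_mult)
  ultimately show ?thesis
    by (simp add: linf_norm_def)
qed

text \<open>
  In each coordinate one of the two sums \<open>w\<^sub>i + v\<^sub>i\<close> and \<open>w\<^sub>i - v\<^sub>i\<close> has no cancellation,
  and this one has absolute value \<open>\<bar>w\<^sub>i\<bar> + 1\<close>. Which half contains it depends on \<open>v\<close>, but the
  maximum over both halves does not.
\<close>

lemma linf_norm_butterfly:
  assumes w: "w \<in> carrier_vec n" and v: "v \<in> sign_vecs n" and n: "0 < n"
  shows "linf_norm ((w + v) @\<^sub>v (w - v)) = linf_norm w + 1"
proof -
  let ?z = "(w + v) @\<^sub>v (w - v)"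
  have dims: "dim_vec w = n" "dim_vec v = n"
    using w v by (auto simp: sign_vecs_def)
  have sgn: "v $ i = 1 \<or> v $ i = -1" if "i < n" for i
    using v that by (auto simp: sign_vecs_def)
  have upper: "\<bar>w $ i\<bar> \<le> linf_norm w" if "i < n" for i
    using that by (auto simp: linf_norm_def dims intro!: Max_ge)
  have "linf_norm w \<in> (\<lambda>i. \<bar>w $ i\<bar>) ` {..<n}"
    unfolding linf_norm_def dims using n by (intro Max_in) auto
  then obtain i where i: "i < n" "linf_norm w = \<bar>w $ i\<bar>"
    by auto
  have attained: "\<exists>j<n + n. linf_norm w + 1 = \<bar>?z $ j\<bar>"
  proof (cases "\<bar>w $ i + v $ i\<bar> = \<bar>w $ i\<bar> + 1")
    case True
    then show ?thesis
      using i dims by (intro exI[of _ i]) auto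
  next
    case False
    then have "\<bar>w $ i - v $ i\<bar> = \<bar>w $ i\<bar> + 1"
      using sgn[OF i(1)] by auto
    then show ?thesis
      using i dims by (intro exI[of _ "n + i"]) auto
  qed
  have bound: "\<bar>?z $ j\<bar> \<le> linf_norm w + 1" if "j < n + n" for j
  proof (cases "j < n")
    case True
    then show ?thesis
      using upper[of j] sgn[of j] dims by auto
  next
    case False
    with that have "j - n < n"
      by auto
    then show ?thesis
      using upper[of "j - n"] sgn[of "j - n"] dims False that by auto
  qed
  have "Max ((\<lambda>j. \<bar>?z $ j\<bar>) ` {..<n + n}) = linf_norm w + 1"
    using bound attained by (intro Max_eqI) auto
  then show ?thesis
    by (simp add: linf_norm_def dims)
qed

lemma sign_vecs_split:
  assumes "x \<in> sign_vecs (m + n)"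
  obtains u v where "u \<in> sign_vecs m" "v \<in> sign_vecs n" "x = u @\<^sub>v v"
proof
  show "vec_first x m \<in> sign_vecs m"
    using assms by (auto simp: sign_vecs_def vec_first_def)
  have "dim_vec x = m + n" "\<forall>i<n. x $ (m + i) \<in> {-1, 1}"
    using assms unfolding sign_vecs_def by simp_all
  then show "vec_last x n \<in> sign_vecs n"
    by (simp add: sign_vecs_def vec_last_def)
  show "x = vec_first x m @\<^sub>v vec_last x n"
    using assms by (simp add: sign_vecs_def)
qed

lemma haar_mat_Suc_mult_append:
  assumes u: "u \<in> carrier_vec (2 ^ k)" and v: "v \<in> carrier_vec (2 ^ k)"
  shows "haar_mat (Suc k) *\<^sub>v (u @\<^sub>v v)
    = (haar_mat k *\<^sub>v u + v) @\<^sub>v (haar_mat k *\<^sub>v u - v)"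
proof -
  have neg: "- 1\<^sub>m (2 ^ k) \<in> carrier_mat (2 ^ k) (2 ^ k)"
    by simp
  have "- 1\<^sub>m (2 ^ k) *\<^sub>v v = - v"
    using v by (simp add: uminus_mult_mat_vec)
  moreover have "haar_mat k *\<^sub>v u + - v = haar_mat k *\<^sub>v u - v"
    using u v haar_mat_carrier[of k] by (intro eq_vecI) auto
  ultimately show ?thesis
    using four_block_mat_mult_vec[OF haar_mat_carrier one_carrier_mat haar_mat_carrier neg u v] v
    by simp
qed

lemma linf_norm_haar_mult:
  "x \<in> sign_vecs (2 ^ k) \<Longrightarrow> linf_norm (haar_mat k *\<^sub>v x) = real k + 1"
proof (induction k arbitrary: x)
  case 0
  then show ?case
    by (auto simp: linf_norm_def sign_vecs_def lessThan_Suc)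
next
  case (Suc k)
  then have "x \<in> sign_vecs (2 ^ k + 2 ^ k)"
    by (simp add: mult_2)
  then obtain u v where uv: "u \<in> sign_vecs (2 ^ k)" "v \<in> sign_vecs (2 ^ k)" "x = u @\<^sub>v v"
    by (rule sign_vecs_split)
  have carr: "u \<in> carrier_vec (2 ^ k)" "v \<in> carrier_vec (2 ^ k)"
    using uv by (auto simp: sign_vecs_def)
  have w: "haar_mat k *\<^sub>v u \<in> carrier_vec (2 ^ k)"
    using haar_mat_carrier carr(1) by (rule mult_mat_vec_carrier)
  show ?case
    unfolding uv(3) haar_mat_Suc_mult_append[OF carr]
    using linf_norm_butterfly[OF w uv(2)] Suc.IH[OF uv(1)] by simp
qed

section \<open>The normalized matrix\<close>

lemma l2_norm_row_normalized_haar: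
  assumes "i < 2 ^ k"
  shows "l2_norm (row (normalized_haar_mat k) i) = 1"
proof -
  have "l2_norm (row (haar_mat k) i) = sqrt (real k + 1)"
    using l2_norm_row_haar[OF assms]
    by (intro real_sqrt_unique[symmetric]) (simp_all add: l2_norm_def L2_set_nonneg)
  moreover have "row (normalized_haar_mat k) i = (1 / sqrt (real k + 1)) \<cdot>\<^sub>v row (haar_mat k) i"
    using assms haar_mat_carrier[of k] by (simp add: normalized_haar_mat_def)
  ultimately show ?thesis
    by (simp add: l2_norm_smult)
qed

lemma linf_norm_normalized_haar_mult:
  assumes x: "x \<in> sign_vecs (2 ^ k)"
  shows "linf_norm (normalized_haar_mat k *\<^sub>v x) = sqrt (real k + 1)"
proof -
  have "x \<in> carrier_vec (2 ^ k)"
    using x by (simp add: sign_vecs_def)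
  then have "normalized_haar_mat k *\<^sub>v x = (1 / sqrt (real k + 1)) \<cdot>\<^sub>v (haar_mat k *\<^sub>v x)"
    using haar_mat_carrier[of k]
    by (intro eq_vecI) (auto simp: normalized_haar_mat_def)
  moreover have "0 < dim_vec (haar_mat k *\<^sub>v x)"
    using haar_mat_carrier[of k] by simp
  ultimately show ?thesis
    by (simp add: linf_norm_smult linf_norm_haar_mult[OF x] real_div_sqrt)
qed

lemma card_sign_vecs: "card (sign_vecs n) = 2 ^ n"
proof -
  have "bij_betw (vec n) ({..<n} \<rightarrow>\<^sub>E {-1, 1}) (sign_vecs n)"
  proof (rule bij_betw_byWitness[where f' = "\<lambda>x. restrict (($) x) {..<n}"])
    show "\<forall>f\<in>{..<n} \<rightarrow>\<^sub>E {-1, 1}. restrict (($) (vec n f)) {..<n} = f"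
      by (auto simp: fun_eq_iff restrict_def PiE_def extensional_def)
    show "\<forall>x\<in>sign_vecs n. vec n (restrict (($) x) {..<n}) = x"
      by (auto simp: sign_vecs_def)
    show "vec n ` ({..<n} \<rightarrow>\<^sub>E {-1, 1}) \<subseteq> sign_vecs n"
      by (fastforce simp: sign_vecs_def dest: PiE_mem)
    show "(\<lambda>x. restrict (($) x) {..<n}) ` sign_vecs n \<subseteq> {..<n} \<rightarrow>\<^sub>E {-1, 1}"
      by (simp add: sign_vecs_def image_subset_iff)
  qed
  then have "card (sign_vecs n) = card ({..<n} \<rightarrow>\<^sub>E {-1, 1 :: real})"
    by (rule bij_betw_same_card[symmetric])
  then show ?thesis
    by (simp add: card_PiE numeral_2_eq_2)
qed

lemma mean_linf_norm_normalized_haar: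
  "mean_linf_norm (2 ^ k) (normalized_haar_mat k) = sqrt (real k + 1)"
  by (simp add: mean_linf_norm_def linf_norm_normalized_haar_mult card_sign_vecs)

section \<open>Asymptotics and the value of the constant\<close>

text \<open>
  Three terms of \<open>ln 2 = 2 (1/3 + 1/(3 \<cdot> 3\<^sup>3) + 1/(5 \<cdot> 3\<^sup>5) + \<dots>)\<close> already give \<open>0.693004\<close>, just above
  \<open>1 / 1.443 = 0.6930007\<dots>\<close>; with two terms the lower bound would fail.
\<close>

lemma inverse_ln2_bounds: "1.442 \<le> 1 / ln (2::real)" "1 / ln (2::real) < 1.443"
proof -
  have "ln (2::real) \<in> {842 / 1215..0.6934}"
    using ln_approx_bounds[of 2 3] by (simp add: eval_nat_numeral)
  then show "1.442 \<le> 1 / ln (2::real)" "1 / ln (2::real) < 1.443"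
    by (auto simp: field_simps)
qed

theorem mainTheorem2:
  shows
    "(\<forall>(k::nat) (n::nat) (A::real mat). n = 2 ^ k \<longrightarrow> A = normalized_haar_mat k \<longrightarrow>
        (\<forall>i<n. l2_norm (row A i) = 1)
      \<and> (\<forall>x\<in>sign_vecs n. \<forall>y\<in>sign_vecs n. linf_norm (A *\<^sub>v x) = linf_norm (A *\<^sub>v y))
      \<and> mean_linf_norm n A = sqrt (log 2 (real n) + 1))
    \<and> (\<lambda>k::nat. mean_linf_norm (2 ^ k) (normalized_haar_mat k))
        \<sim>[at_top] (\<lambda>k. sqrt (1 / ln 2 * ln (real (2 ^ k))))
    \<and> 1.442 \<le> 1 / ln (2::real) \<and> 1 / ln (2::real) < 1.443"
proof (intro conjI allI impI ballI)
  fix k n :: nat and A :: "real mat"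
  assume n: "n = 2 ^ k" and A: "A = normalized_haar_mat k"
  show "l2_norm (row A i) = 1" if "i < n" for i
    using that by (simp add: n A l2_norm_row_normalized_haar)
  show "linf_norm (A *\<^sub>v x) = linf_norm (A *\<^sub>v y)" if "x \<in> sign_vecs n" "y \<in> sign_vecs n" for x y
    using that by (simp add: n A linf_norm_normalized_haar_mult)
  show "mean_linf_norm n A = sqrt (log 2 (real n) + 1)"
    by (simp add: n A mean_linf_norm_normalized_haar log_nat_power)
next
  have "(\<lambda>k. sqrt (real k + 1)) \<sim>[at_top] (\<lambda>k. sqrt (real k))"
    by real_asymp
  then show "(\<lambda>k::nat. mean_linf_norm (2 ^ k) (normalized_haar_mat k))
      \<sim>[at_top] (\<lambda>k. sqrt (1 / ln 2 * ln (real (2 ^ k))))"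
    by (simp add: mean_linf_norm_normalized_haar ln_realpow)
qed (rule inverse_ln2_bounds)+

end
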